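(* Let $s\ge 1$ be an integer and let $\mu$ be the Möbius function of the poset $P_s^{*}$. Then for all integers $0\le m\le n$, the value $\mu(a_1^{m},c^{n})$ equals the coefficient of $X^{n-m}$ in the polynomial $T^{s}_{m+n}(X)$.
   Context: For an integer $s\ge 1$, $P_s=\{a_1,\dots,a_s,c\}$ is the poset with $s+1$ elements whose only strict relations are $a_i<c$ for $i=1,\dots,s$. $P_s^{*}$ is the set of all finite words (including the empty word) over the alphabet $P_s$, with the generalized subword order: $p_1\cdots p_k\le q_1\cdots q_l$ iff there exist indices $1\le j_1<\dots<j_k\le l$ with $p_i\le q_{j_i}$ in $P_s$ for all $1\le i\le k$. For a letter $x$, $x^{k}$ denotes the word $x\cdots x$ of length $k$ ($x^0$ is the empty word). The generalized Chebyshev polynomials $T^s_k(X)$, $k\ge 0$, are defined by $T^s_0(X)=1$, $T^s_1(X)=(s-1)X$, and $T^s_{k+2}(X)+T^s_k(X)=sX\cdot T^s_{k+1}(X)$ for $k\ge 0$. *)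

theory Defs
  imports Complex_Main "HOL-Library.Sublist" "HOL-Computational_Algebra.Polynomial"
begin

locale locally_finite_poset =
  fixes A :: "'a set" and r :: "'a rel"
  assumes partial_order: "partial_order_on A r"
    and finite_interval: "\<lbrakk>x \<in> A; y \<in> A\<rbrakk> \<Longrightarrow> finite {z. (x, z) \<in> r \<and> (z, y) \<in> r}"
begin

function mobius :: "'a \<Rightarrow> 'a \<Rightarrow> int" where
  "mobius x y =
    (if (x, y) \<notin> r then 0
     else if x = y then 1
     else - (\<Sum>z | (x, z) \<in> r \<and> (z, y) \<in> r \<and> z \<noteq> y. mobius x z))"
  by auto
termination
proof (relation "Wellfounded.measure (\<lambda>(x, y). card {z. (x, z) \<in> r \<and> (z, y) \<in> r})")
  fix x y z
  assume xy: "\<not> (x, y) \<notin> r" and z: "z \<in> {z. (x, z) \<in> r \<and> (z, y) \<in> r \<and> z \<noteq> y}"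
  have sub: "r \<subseteq> A \<times> A" and tr: "trans r" and an: "antisym r"
    using partial_order by (auto simp: order_on_defs)
  have "{w. (x, w) \<in> r \<and> (w, z) \<in> r} \<subseteq> {w. (x, w) \<in> r \<and> (w, y) \<in> r}"
    using z tr by (auto dest: transD)
  moreover have "y \<in> {w. (x, w) \<in> r \<and> (w, y) \<in> r}"
    using xy sub partial_order by (auto simp: order_on_defs refl_on_def)
  moreover have "y \<notin> {w. (x, w) \<in> r \<and> (w, z) \<in> r}"
    using z an by (auto dest: antisymD)
  ultimately have "{w. (x, w) \<in> r \<and> (w, z) \<in> r} \<subset> {w. (x, w) \<in> r \<and> (w, y) \<in> r}"
    by blast
  moreover have "finite {w. (x, w) \<in> r \<and> (w, y) \<in> r}"
    using xy sub by (intro finite_interval) auto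
  ultimately show "((x, z), (x, y)) \<in> Wellfounded.measure (\<lambda>(x, y). card {z. (x, z) \<in> r \<and> (z, y) \<in> r})"
    by (auto intro: psubset_card_mono)
qed simp

declare mobius.simps [simp del]

end

datatype letter = La nat | Lc

definition P :: "nat \<Rightarrow> letter set" where
  "P s = La ` {1..s} \<union> {Lc}"

definition P_order :: "nat \<Rightarrow> letter rel" where
  "P_order s = Id_on (P s) \<union> {(La i, Lc) | i. i \<in> {1..s}}"

definition P_words_order :: "nat \<Rightarrow> letter list rel" where
  "P_words_order s =
    {(u, v). u \<in> lists (P s) \<and> v \<in> lists (P s) \<and> list_emb (\<lambda>p q. (p, q) \<in> P_order s) u v}"

(* The usual description of list_emb by positions of the embedded letters, 0-based. *)
lemma list_emb_iff_indices:
  "list_emb R u v \<longleftrightarrow>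
    (\<exists>j. strict_mono_on {..<length u} j \<and>
         (\<forall>i<length u. j i < length v \<and> R (u ! i) (v ! j i)))"
proof
  assume "list_emb R u v"
  then show "\<exists>j. strict_mono_on {..<length u} j \<and>
         (\<forall>i<length u. j i < length v \<and> R (u ! i) (v ! j i))"
  proof induction
    case (list_emb_Nil ys)
    show ?case by (auto simp: strict_mono_on_def)
  next
    case (list_emb_Cons xs ys y)
    then obtain j where "strict_mono_on {..<length xs} j"
      "\<forall>i<length xs. j i < length ys \<and> R (xs ! i) (ys ! j i)" by blast
    then show ?case
      by (intro exI[of _ "\<lambda>i. Suc (j i)"]) (auto simp: strict_mono_on_def)
  next
    case (list_emb_Cons2 x y xs ys)
    then obtain j where "strict_mono_on {..<length xs} j"
      "\<forall>i<length xs. j i < length ys \<and> R (xs ! i) (ys ! j i)" by blast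
    then show ?case using \<open>R x y\<close>
      by (intro exI[of _ "\<lambda>i. case i of 0 \<Rightarrow> 0 | Suc k \<Rightarrow> Suc (j k)"])
        (auto simp: strict_mono_on_def nth_Cons split: nat.splits)
  qed
next
  assume "\<exists>j. strict_mono_on {..<length u} j \<and>
         (\<forall>i<length u. j i < length v \<and> R (u ! i) (v ! j i))"
  then show "list_emb R u v"
  proof (induction v arbitrary: u)
    case Nil
    then show ?case by (cases u) auto
  next
    case (Cons y ys)
    then obtain j where j: "strict_mono_on {..<length u} j"
      and jR: "\<And>i. i < length u \<Longrightarrow> j i < length (y # ys) \<and> R (u ! i) ((y # ys) ! j i)" by blast
    show ?case
    proof (cases u)
      case Nil
      then show ?thesis by simp
    next
      case u: (Cons x xs)
      have pos: "j (Suc i) > 0" if "i < length xs" for i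
        using strict_mono_onD[OF j, of i "Suc i"] that u by auto
      have tail: "list_emb R xs ys"
      proof (rule Cons.IH, intro exI conjI allI impI)
        show "strict_mono_on {..<length xs} (\<lambda>i. j (Suc i) - 1)"
        proof (rule strict_mono_onI)
          fix i k assume "i \<in> {..<length xs}" "k \<in> {..<length xs}" "i < k"
          then show "j (Suc i) - 1 < j (Suc k) - 1"
            using strict_mono_onD[OF j, of "Suc i" "Suc k"] pos[of i] u by auto
        qed
        fix i assume i: "i < length xs"
        show "j (Suc i) - 1 < length ys" using jR[of "Suc i"] pos[OF i] i u by auto
        show "R (xs ! i) (ys ! (j (Suc i) - 1))" using jR[of "Suc i"] pos[OF i] i u by auto
      qed
      show ?thesis
      proof (cases "j 0")
        case 0
        then show ?thesis using tail jR[of 0] u by auto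
      next
        case (Suc k)
        have gt: "j i > 0" if "i < length u" for i
          using that pos Suc u by (cases i) auto
        have "list_emb R u ys"
        proof (rule Cons.IH, intro exI conjI allI impI)
          show "strict_mono_on {..<length u} (\<lambda>i. j i - 1)"
          proof (rule strict_mono_onI)
            fix i k assume "i \<in> {..<length u}" "k \<in> {..<length u}" "i < k"
            then show "j i - 1 < j k - 1"
              using strict_mono_onD[OF j, of i k] gt[of i] by auto
          qed
          fix i assume i: "i < length u"
          show "j i - 1 < length ys" using jR[OF i] gt[OF i] by auto
          show "R (u ! i) (ys ! (j i - 1))" using jR[OF i] gt[OF i] by (auto simp: nth_Cons')
        qed
        then show ?thesis by blast
      qed
    qed
  qed
qed

lemma list_emb_antisym:
  assumes anti: "\<And>x y. R x y \<Longrightarrow> R y x \<Longrightarrow> x = y"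
    and "list_emb R u v" "list_emb R v u"
  shows "u = v"
  using assms(2,3)
proof induction
  case (list_emb_Nil ys)
  then show ?case using list_emb_Nil2 by blast
next
  case (list_emb_Cons xs ys y)
  then show ?case
    using list_emb_length[of R xs ys] list_emb_length[of R "y # ys" xs] by simp
next
  case (list_emb_Cons2 x y xs ys)
  from \<open>list_emb R (y # ys) (x # xs)\<close> show ?case
  proof cases
    case list_emb_Cons
    then show ?thesis
      using list_emb_length[of R "y # ys" xs] list_emb_length[OF list_emb_Cons2.hyps(2)] by simp
  next
    case list_emb_Cons2
    then show ?thesis using list_emb_Cons2.IH anti \<open>R x y\<close> by blast
  qed
qed

interpretation P_words: locally_finite_poset "lists (P s)" "P_words_order s" for s
proof
  have refl: "(p, p) \<in> P_order s" if "p \<in> P s" for p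
    using that by (auto simp: P_order_def)
  have tr: "(p, t) \<in> P_order s" if "(p, q) \<in> P_order s" "(q, t) \<in> P_order s" for p q t
    using that by (auto simp: P_order_def)
  have an: "p = q" if "(p, q) \<in> P_order s" "(q, p) \<in> P_order s" for p q
    using that by (auto simp: P_order_def)
  have "list_emb (\<lambda>p q. (p, q) \<in> P_order s) u u" if "u \<in> lists (P s)" for u
    using that by (induction u) (auto intro: refl)
  then have "refl_on (lists (P s)) (P_words_order s)"
    by (auto simp: P_words_order_def refl_on_def)
  moreover have "trans (P_words_order s)"
    by (rule transI) (auto simp: P_words_order_def intro: list_emb_trans tr)
  moreover have "antisym (P_words_order s)"
    by (rule antisymI) (auto simp: P_words_order_def intro: list_emb_antisym[OF an])
  ultimately show "partial_order_on (lists (P s)) (P_words_order s)"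
    by (auto simp: order_on_defs P_words_order_def)
next
  fix u v :: "letter list"
  have "finite {w. set w \<subseteq> P s \<and> length w \<le> length v}"
    by (rule finite_lists_length_le) (simp add: P_def)
  then show "finite {w. (u, w) \<in> P_words_order s \<and> (w, v) \<in> P_words_order s}"
    by (rule rev_finite_subset) (auto simp: P_words_order_def dest: list_emb_length)
qed

fun gen_Chebyshev :: "nat \<Rightarrow> nat \<Rightarrow> int poly" where
  "gen_Chebyshev s 0 = 1"
| "gen_Chebyshev s (Suc 0) = [:0, int s - 1:]"
| "gen_Chebyshev s (Suc (Suc k)) = [:0, int s:] * gen_Chebyshev s (Suc k) - gen_Chebyshev s k"

end

theory Submission
  imports Defs
begin

text \<open>
  For a word \<open>z\<close> let \<open>\<Phi>(z)\<close> be the product of one factor per letter \<open>x\<close> of \<open>z\<close>: a weight \<open>\<alpha>(x)\<close>,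
  increased by one if the next letter is again \<open>x\<close>. Embedding greedily from the left shows that the
  sum of \<open>\<Phi>(z)\<close> over all \<open>z \<le> w\<close> is the product of \<open>1 + (\<Sum>x \<le> y. \<alpha>(x))\<close> over the letters \<open>y\<close> of
  \<open>w\<close>. With \<open>\<alpha>(a\<^sub>1) = X - 1\<close>, \<open>\<alpha>(a\<^sub>i) = -1\<close> for \<open>i > 1\<close> and \<open>\<alpha>(c) = s - 1 - X\<close> these factors are
  \<open>X\<close>, \<open>0\<close> and \<open>0\<close>, so the sum is \<open>X\<^sup>k\<close> if \<open>w = a\<^sub>1\<^sup>k\<close> and \<open>0\<close> otherwise. Comparing coefficients of
  \<open>X\<^sup>m\<close>, the value \<open>\<mu>(a\<^sub>1\<^sup>m, w)\<close> is the coefficient of \<open>X\<^sup>m\<close> in \<open>\<Phi>(w)\<close>. Finally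
  \<open>\<Phi>(c\<^sup>n) = (s - 1 - X) (s - X)\<^sup>n\<^sup>-\<^sup>1\<close>, whose coefficients obey the Chebyshev recursion.
  This is the special case \<open>u = a\<^sub>1\<^sup>m\<close> of the formula of McNamara and Sagan for generalized subword
  order.
\<close>

text \<open>The interval sums determine \<open>g\<close> on the elements above \<open>x\<close> by
  the same recursion as \<open>mobius\<close>: the sum up to \<open>y\<close> isolates
  \<open>g y\<close>, and induction handles the smaller terms.\<close>

lemma (in locally_finite_poset) mobius_eqI:
  assumes "(x, y) \<in> r"
    and "\<And>y. (x, y) \<in> r \<Longrightarrow> (\<Sum>z | (x, z) \<in> r \<and> (z, y) \<in> r. g z) = (if x = y then 1 else 0)"
  shows "mobius x y = g y"
  using assms
proof (induction x y rule: mobius.induct)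
  case (1 x y)
  let ?I = "{z. (x, z) \<in> r \<and> (z, y) \<in> r}"
  let ?J = "{z. (x, z) \<in> r \<and> (z, y) \<in> r \<and> z \<noteq> y}"
  have sub: "r \<subseteq> A \<times> A" and refl: "refl_on A r" and anti: "antisym r"
    using partial_order by (auto simp: order_on_defs)
  have xy: "x \<in> A" "y \<in> A" "(x, x) \<in> r" "(y, y) \<in> r"
    using sub refl \<open>(x, y) \<in> r\<close> by (auto simp: refl_on_def)
  have I: "?I = insert y ?J"
    using \<open>(x, y) \<in> r\<close> xy by auto
  have sum: "g y + sum g ?J = (if x = y then 1 else 0)"
    using "1.prems"(2)[OF \<open>(x, y) \<in> r\<close>] finite_interval[OF xy(1,2)] unfolding I by simp
  show ?case
  proof (cases "x = y")
    case True
    then have J: "?J = {}"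
      using anti by (auto dest: antisymD)
    have "g y = 1"
      using sum True unfolding J by simp
    then show ?thesis
      using True xy by (simp add: mobius.simps)
  next
    case False
    have "(\<Sum>z\<in>?J. mobius x z) = sum g ?J"
      using 1 False by (intro sum.cong) auto
    then show ?thesis
      using False sum \<open>(x, y) \<in> r\<close> mobius.simps[of x y] by simp
  qed
qed

section \<open>Sums of repetition weights over embedded words\<close>

fun repeat_weight :: "('a \<Rightarrow> 'b::comm_ring_1) \<Rightarrow> 'a list \<Rightarrow> 'b" where
  "repeat_weight \<alpha> [] = 1"
| "repeat_weight \<alpha> (x # z) = (\<alpha> x + of_bool (z \<noteq> [] \<and> hd z = x)) * repeat_weight \<alpha> z"

text \<open>Greedy embedding: if the head of \<open>z\<close> fits under \<open>y\<close>, it may be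
  matched there without loss. Excluding such heads from the second set makes the union
  disjoint.\<close>

lemma list_emb_Cons_right_set:
  "{z. list_emb R z (y # w)} =
    (\<lambda>(x, z). x # z) ` ({x. R x y} \<times> {z. list_emb R z w}) \<union>
    {z. list_emb R z w \<and> \<not> (z \<noteq> [] \<and> R (hd z) y)}" (is "?L = ?R")
proof (intro set_eqI)
  show "z \<in> ?L \<longleftrightarrow> z \<in> ?R" for z
  proof (cases z)
    case (Cons x u)
    have "z \<in> (\<lambda>(x, z). x # z) ` ({x. R x y} \<times> {z. list_emb R z w}) \<longleftrightarrow> R x y \<and> list_emb R u w"
      unfolding Cons by auto
    then show ?thesis
      using list_emb_code(3)[of R x u y w] by (auto simp: Cons)
  qed auto
qed

lemma finite_list_emb:
  assumes "\<And>y. finite {x. R x y}"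
  shows "finite {z. list_emb R z w}"
proof (induction w)
  case Nil
  then show ?case
    by (rule finite_subset[of _ "{[]}"]) auto
next
  case (Cons y w)
  then show ?case
    unfolding list_emb_Cons_right_set using assms by auto
qed

lemma sum_repeat_weight_Cons:
  fixes \<alpha> :: "'a \<Rightarrow> 'b::comm_ring_1"
  assumes fin: "\<And>y. finite {x. R x y}"
  shows "(\<Sum>z | list_emb R z (y # w). repeat_weight \<alpha> z) =
    (1 + (\<Sum>x | R x y. \<alpha> x)) * (\<Sum>z | list_emb R z w. repeat_weight \<alpha> z)"
proof -
  let ?X = "{x. R x y}" and ?D = "{z. list_emb R z w}" and ?W = "repeat_weight \<alpha>"
  let ?C = "\<lambda>(x, z). x # z"
  let ?Q = "\<lambda>z. z \<noteq> [] \<and> R (hd z) y"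
  have finD: "finite ?D"
    by (rule finite_list_emb[OF fin])
  have "(\<Sum>z | list_emb R z (y # w). ?W z) =
      sum ?W (?C ` (?X \<times> ?D)) + (\<Sum>z | list_emb R z w \<and> \<not> ?Q z. ?W z)"
    unfolding list_emb_Cons_right_set using fin finD by (intro sum.union_disjoint) auto
  also have "sum ?W (?C ` (?X \<times> ?D)) = (\<Sum>p\<in>?X \<times> ?D. ?W (?C p))"
    by (subst sum.reindex) (auto simp: inj_on_def)
  also have "\<dots> = (\<Sum>x\<in>?X. \<Sum>z\<in>?D. ?W (x # z))"
    by (simp add: sum.cartesian_product split_def)
  also have "\<dots> = (\<Sum>x\<in>?X. \<alpha> x) * sum ?W ?D +
      (\<Sum>x\<in>?X. \<Sum>z\<in>?D. of_bool (z \<noteq> [] \<and> hd z = x) * ?W z)"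
    by (simp add: distrib_right sum.distrib sum_product)
  also have "(\<Sum>x\<in>?X. \<Sum>z\<in>?D. of_bool (z \<noteq> [] \<and> hd z = x) * ?W z) =
      (\<Sum>z\<in>?D. \<Sum>x\<in>?X. if x = hd z then of_bool (z \<noteq> []) * ?W z else 0)"
    by (subst sum.swap) (intro sum.cong, auto)
  \<comment> \<open>The repetition bonus survives only for \<open>x = hd z\<close>, and such an
    \<open>x\<close> lies in \<open>?X\<close> exactly when the head of \<open>z\<close> fits under
    \<open>y\<close>.\<close>
  also have "\<dots> = (\<Sum>z\<in>?D. if ?Q z then ?W z else 0)"
    using fin by (intro sum.cong) auto
  also have "\<dots> = (\<Sum>z | list_emb R z w \<and> ?Q z. ?W z)"
    using sum.inter_filter[OF finD, of ?W ?Q] by simp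
  \<comment> \<open>The bonus supplies just the words that the greedy split left out, so the last
    two sums together run over all of \<open>?D\<close>.\<close>
  also have "(\<Sum>x\<in>?X. \<alpha> x) * sum ?W ?D + (\<Sum>z | list_emb R z w \<and> ?Q z. ?W z) +
      (\<Sum>z | list_emb R z w \<and> \<not> ?Q z. ?W z) = (\<Sum>x\<in>?X. \<alpha> x) * sum ?W ?D + sum ?W ?D"
    unfolding add.assoc using finD
    by (subst sum.union_disjoint[symmetric]) (auto intro!: sum.cong arg_cong2[where f = "(+)"])
  finally show ?thesis
    by (simp add: distrib_right)
qed

lemma sum_repeat_weight:
  fixes \<alpha> :: "'a \<Rightarrow> 'b::comm_ring_1"
  assumes "\<And>y. finite {x. R x y}"
  shows "(\<Sum>z | list_emb R z w. repeat_weight \<alpha> z) =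
    prod_list (map (\<lambda>y. 1 + (\<Sum>x | R x y. \<alpha> x)) w)"
proof (induction w)
  case Nil
  have "{z. list_emb R z []} = {[]}"
    by auto
  then show ?case
    by simp
next
  case (Cons y w)
  then show ?case
    by (simp add: sum_repeat_weight_Cons[OF assms])
qed

section \<open>Weights adapted to the letter poset\<close>

lemma P_order_below_La:
  "i \<in> {1..s} \<Longrightarrow> {x. (x, La i) \<in> P_order s} = {La i}"
  by (auto simp: P_order_def P_def)

lemma P_order_below_Lc:
  "{x. (x, Lc) \<in> P_order s} = insert Lc (La ` {1..s})"
  by (auto simp: P_order_def P_def)

lemma finite_P_order_below: "finite {x. (x, y) \<in> P_order s}"
  by (rule finite_subset[of _ "P s"]) (auto simp: P_order_def P_def)

lemma list_emb_P_order_lists: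
  assumes "list_emb (\<lambda>p q. (p, q) \<in> P_order s) u v"
    and "v \<in> lists (P s)"
  shows "u \<in> lists (P s)"
  using assms by induction (auto simp: P_order_def P_def)

text \<open>On \<open>P s\<close> these values are forced: they solve 1 + (sum of the weights below
  y) = X for y = \<open>La 1\<close> and = 0 for every other letter y.\<close>

fun letter_weight :: "nat \<Rightarrow> letter \<Rightarrow> int poly" where
  "letter_weight s (La i) = [:- 1, of_bool (i = 1):]"
| "letter_weight s Lc = [:int s - 1, - 1:]"

lemma sum_letter_weight_below:
  assumes "s \<ge> 1" and "y \<in> P s"
  shows "1 + (\<Sum>x | (x, y) \<in> P_order s. letter_weight s x) = (if y = La 1 then [:0, 1:] else 0)"
proof (cases y)
  case (La i)
  then have "i \<in> {1..s}"
    using assms by (auto simp: P_def)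
  then show ?thesis
    by (simp add: La P_order_below_La one_pCons del: atLeastAtMost_iff)
next
  case Lc
  have "(\<Sum>i\<in>{1..s}. letter_weight s (La i)) = (\<Sum>i\<in>{1..s}. [:- 1:] + (if i = 1 then [:0, 1:] else 0))"
    by (intro sum.cong) auto
  also have "\<dots> = [:- int s, 1:]"
    using assms by (simp add: sum.distrib of_nat_poly)
  finally have "(\<Sum>x\<in>La ` {1..s}. letter_weight s x) = [:- int s, 1:]"
    by (subst sum.reindex) (auto simp: inj_on_def)
  then show ?thesis
    by (simp add: Lc P_order_below_Lc image_iff one_pCons)
qed

lemma sum_repeat_letter_weight:
  assumes "s \<ge> 1" and "w \<in> lists (P s)"
  shows "(\<Sum>z | (z, w) \<in> P_words_order s. repeat_weight (letter_weight s) z) =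
    (if w = replicate (length w) (La 1) then monom 1 (length w) else 0)"
proof -
  have "{z. (z, w) \<in> P_words_order s} = {z. list_emb (\<lambda>p q. (p, q) \<in> P_order s) z w}"
    using assms(2) list_emb_P_order_lists[of s _ w] by (auto simp: P_words_order_def)
  then have "(\<Sum>z | (z, w) \<in> P_words_order s. repeat_weight (letter_weight s) z) =
      prod_list (map (\<lambda>y. 1 + (\<Sum>x | (x, y) \<in> P_order s. letter_weight s x)) w)"
    by (simp add: sum_repeat_weight finite_P_order_below)
  also have "\<dots> = (if w = replicate (length w) (La 1) then monom 1 (length w) else 0)"
    using assms(2)
    by (induction w) (simp_all add: sum_letter_weight_below[OF assms(1)] monom_Suc)
  finally show ?thesis .
qed

section \<open>Moebius values as coefficients\<close>

lemma coeff_linear_mult: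
  "coeff ([:a, b:] * p) k = a * coeff p k + (case k of 0 \<Rightarrow> 0 | Suc i \<Rightarrow> b * coeff p i)"
  by (simp add: coeff_pCons split: nat.split)

text \<open>Only the letters above \<open>La 1\<close> contribute a factor involving X, so a term in
  X^m needs m of them. Hence an interval sum starting at \<open>replicate m (La 1)\<close> may be
  extended to all words below \<open>w\<close>.\<close>

lemma replicate_below_if_coeff_nonzero:
  assumes "s \<ge> 1" and "z \<in> lists (P s)"
    and "coeff (repeat_weight (letter_weight s) z) m \<noteq> 0"
  shows "(replicate m (La 1), z) \<in> P_words_order s"
proof -
  have "list_emb (\<lambda>p q. (p, q) \<in> P_order s) (replicate m (La 1)) z"
    using assms(3)
  proof (induction z arbitrary: m)
    case Nil
    then show ?case
      by (cases m) auto
  next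
    case (Cons x z)
    \<comment> \<open>The repetition bonus changes only the constant term, so every factor is linear
      with slope \<open>b\<close>.\<close>
    define a b where "a = coeff (letter_weight s x) 0 + of_bool (z \<noteq> [] \<and> hd z = x)"
      and "b = coeff (letter_weight s x) 1"
    note ab_defs = this
    have "letter_weight s x = [:coeff (letter_weight s x) 0, coeff (letter_weight s x) 1:]"
      by (cases x) simp_all
    moreover have "of_bool (z \<noteq> [] \<and> hd z = x) = [:of_bool (z \<noteq> [] \<and> hd z = x) :: int:]"
      by (cases "z \<noteq> [] \<and> hd z = x") (simp_all add: one_pCons)
    ultimately have ab: "letter_weight s x + of_bool (z \<noteq> [] \<and> hd z = x) = [:a, b:]"
      unfolding ab_defs by (metis add_pCons add.right_neutral)
    have b: "x = La 1 \<or> x = Lc" if "b \<noteq> 0"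
      using that unfolding ab_defs by (cases x) (auto split: if_splits)
    have nz: "coeff ([:a, b:] * repeat_weight (letter_weight s) z) m \<noteq> 0"
      using Cons.prems unfolding repeat_weight.simps ab .
    show ?case
    proof (cases "coeff (repeat_weight (letter_weight s) z) m = 0")
      case False
      then show ?thesis
        using Cons.IH by blast
    next
      case True
      then obtain k where m: "m = Suc k" and "b \<noteq> 0"
        and "coeff (repeat_weight (letter_weight s) z) k \<noteq> 0"
        using nz unfolding coeff_linear_mult by (auto split: nat.splits)
      moreover have "(La 1, x) \<in> P_order s"
        using b[OF \<open>b \<noteq> 0\<close>] assms(1) by (auto simp: P_order_def P_def)
      ultimately show ?thesis
        using Cons.IH by auto
    qed
  qed
  moreover have "replicate m (La 1) \<in> lists (P s)"
    using assms(1) by (auto simp: P_def)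
  ultimately show ?thesis
    using assms(2) by (simp add: P_words_order_def)
qed

lemma mobius_replicate_La:
  assumes "s \<ge> 1" and "(replicate m (La 1), w) \<in> P_words_order s"
  shows "P_words.mobius s (replicate m (La 1)) w = coeff (repeat_weight (letter_weight s) w) m"
proof (rule P_words.mobius_eqI[OF assms(2)])
  fix w
  let ?u = "replicate m (La 1)" and ?g = "\<lambda>z. coeff (repeat_weight (letter_weight s) z) m"
  assume uw: "(?u, w) \<in> P_words_order s"
  then have w: "w \<in> lists (P s)"
    by (simp add: P_words_order_def)
  have fin: "finite {z. (z, w) \<in> P_words_order s}"
    by (rule finite_subset[OF _ finite_list_emb[where w = w, OF finite_P_order_below[of _ s]]])
      (auto simp: P_words_order_def)
  have "(\<Sum>z | (?u, z) \<in> P_words_order s \<and> (z, w) \<in> P_words_order s. ?g z) =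
      (\<Sum>z | (z, w) \<in> P_words_order s. ?g z)"
    using fin replicate_below_if_coeff_nonzero[OF assms(1)]
    by (intro sum.mono_neutral_left) (auto simp: P_words_order_def)
  also have "\<dots> = coeff (\<Sum>z | (z, w) \<in> P_words_order s. repeat_weight (letter_weight s) z) m"
    by (simp add: coeff_sum)
  also have "\<dots> = (if ?u = w then 1 else 0)"
    unfolding sum_repeat_letter_weight[OF assms(1) w] by auto
  finally show "(\<Sum>z | (?u, z) \<in> P_words_order s \<and> (z, w) \<in> P_words_order s. ?g z) =
      (if ?u = w then 1 else 0)" .
qed

section \<open>Comparison with the Chebyshev recursion\<close>

lemma repeat_letter_weight_replicate_Lc:
  "repeat_weight (letter_weight s) (replicate (Suc n) Lc) = [:int s, - 1:] ^ n * [:int s - 1, - 1:]"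
proof (induction n)
  case (Suc n)
  have "[:int s - 1, - 1:] + 1 = [:int s, - 1:]"
    by (simp add: one_pCons)
  moreover have "repeat_weight (letter_weight s) (replicate (Suc (Suc n)) Lc) =
      ([:int s - 1, - 1:] + 1) * repeat_weight (letter_weight s) (replicate (Suc n) Lc)"
    by simp
  ultimately show ?case
    by (simp only: Suc.IH power_Suc mult.assoc)
qed simp

lemma coeff_gen_Chebyshev_eq_0: "i > k \<Longrightarrow> coeff (gen_Chebyshev s k) i = 0"
  by (induction s k arbitrary: i rule: gen_Chebyshev.induct)
    (auto simp: coeff_pCons split: nat.splits)

text \<open>Multiplication by s - X and the Chebyshev recursion give the same rule: s times the
  entry at (n, m) minus the entry at (n, m - 1). The bound on \<open>m\<close> keeps the subtraction
  from truncating.\<close>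

lemma coeff_gen_Chebyshev_Suc:
  assumes "m \<le> Suc n"
  shows "coeff (gen_Chebyshev s (m + Suc n)) (Suc n - m) =
    coeff ([:int s, - 1:] ^ n * [:int s - 1, - 1:]) m"
  using assms
proof (induction n arbitrary: m)
  case 0
  then have "m = 0 \<or> m = 1"
    by auto
  then show ?case
    by auto
next
  case (Suc n)
  let ?q = "\<lambda>n. [:int s, - 1:] ^ n * [:int s - 1, - 1:]"
  have "coeff (?q (Suc n)) m =
      int s * coeff (?q n) m - (case m of 0 \<Rightarrow> 0 | Suc i \<Rightarrow> coeff (?q n) i)"
    unfolding power_Suc mult.assoc coeff_linear_mult by (simp split: nat.split)
  moreover have "coeff (gen_Chebyshev s (m + Suc (Suc n))) (Suc (Suc n) - m) =
      int s * coeff ([:0, 1:] * gen_Chebyshev s (m + Suc n)) (Suc (Suc n) - m) -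
      coeff (gen_Chebyshev s (m + n)) (Suc (Suc n) - m)"
    by (simp add: coeff_pCons split: nat.split)
  moreover have "coeff ([:0, 1:] * gen_Chebyshev s (m + Suc n)) (Suc (Suc n) - m) = coeff (?q n) m"
  proof (cases "m = Suc (Suc n)")
    \<comment> \<open>Outside the range of the induction hypothesis both sides vanish: the index on
      the left is 0 and the factor X kills it, while \<open>?q n\<close> has degree at most n +
      1.\<close>
    case True
    have "degree (?q n) \<le> degree ([:int s, - 1:] ^ n) + degree [:int s - 1, - 1:]"
      by (rule degree_mult_le)
    also have "\<dots> < m"
      using degree_power_le[of "[:int s, - 1:]" n] True by simp
    finally have "coeff (?q n) m = 0"
      by (rule coeff_eq_0)
    then show ?thesis
      using True by simp
  next
    case False
    then have "m \<le> Suc n"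
      using Suc.prems by simp
    then show ?thesis
      using Suc.IH[of m] by (simp add: Suc_diff_le del: mult_pCons_right)
  qed
  moreover have "coeff (gen_Chebyshev s (m + n)) (Suc (Suc n) - m) =
      (case m of 0 \<Rightarrow> 0 | Suc i \<Rightarrow> coeff (?q n) i)"
  proof (cases m)
    \<comment> \<open>There is no entry at m - 1 here; the degree bound makes the left side 0 as
      well.\<close>
    case 0
    then show ?thesis
      by (simp add: coeff_gen_Chebyshev_eq_0)
  next
    case (Suc i)
    then show ?thesis
      using Suc.IH[of i] Suc.prems by simp
  qed
  ultimately show ?case
    by simp
qed

theorem theorem1:
  fixes s m n :: nat
  assumes "s \<ge> 1" and "m \<le> n"
  shows "P_words.mobius s (replicate m (La 1)) (replicate n Lc) =
    coeff (gen_Chebyshev s (m + n)) (n - m)"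
proof -
  have "list_emb (\<lambda>p q. (p, q) \<in> P_order s) (replicate m (La 1)) (replicate n Lc)"
    using assms(2)
  proof (induction m n rule: diff_induct)
    case (3 m n)
    then show ?case
      using assms(1) by (auto simp: P_order_def)
  qed auto
  then have "(replicate m (La 1), replicate n Lc) \<in> P_words_order s"
    using assms(1) by (auto simp: P_words_order_def P_def)
  then have mobius: "P_words.mobius s (replicate m (La 1)) (replicate n Lc) =
      coeff (repeat_weight (letter_weight s) (replicate n Lc)) m"
    by (rule mobius_replicate_La[OF assms(1)])
  show ?thesis
  proof (cases n)
    \<comment> \<open>The closed form for powers of \<open>Lc\<close> needs a nonempty word; here
      \<open>m = 0\<close> and both sides are 1.\<close>
    case 0
    then show ?thesis
      using mobius assms(2) by simp
  next
    case (Suc k)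
    then show ?thesis
      using mobius assms(2) coeff_gen_Chebyshev_Suc[of m k s]
      by (simp only: repeat_letter_weight_replicate_Lc)
  qed
qed

end
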